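(* Let $\alpha>0$ and $\lambda>0$, let $n$ be the smallest integer greater than or equal to $\alpha$, let $h\ge 1$ be an integer, and let $m\ge n$ be an integer. Then for all $t>0$, $$\mathcal{D}^{\alpha}B_m^{(h)}(t\mid\lambda)=\frac{\Gamma(m+1)}{\Gamma(m-n+1)}\sum_{k=0}^{m-n}\frac{k!\binom{m-n}{k}}{\Gamma(n+k-\alpha+1)}\,t^{k-\alpha+n}\left(\sum_{\substack{s_1+s_2+\cdots+s_h=m-n-k\\ s_1,\dots,s_h\ge 0}}\binom{m-n-k}{s_1,s_2,\dots,s_h}\prod_{j=1}^{h}B_{s_j}(\lambda)\right).$$
   Context: The Apostol-Bernoulli numbers $B_s(\lambda)$ are defined by the power series expansion at $z=0$: $\frac{z}{\lambda e^{z}-1}=\sum_{s=0}^{\infty}B_s(\lambda)\frac{z^s}{s!}$. The Apostol-Bernoulli polynomials of order $h$, $B_m^{(h)}(t\mid\lambda)$, are defined by $$\left(\frac{z}{\lambda e^{z}-1}\right)^{h}e^{tz}=\sum_{m=0}^{\infty}B_m^{(h)}(t\mid\lambda)\frac{z^m}{m!}.$$ Here $\binom{N}{s_1,\dots,s_h}=\frac{N!}{s_1!\cdots s_h!}$ is the multinomial coefficient. For $\alpha>0$ and $n$ the smallest integer $\ge\alpha$, the Caputo fractional derivative of order $\alpha$ of a function $f:(0,\infty)\to\mathbb{R}$ is $$\mathcal{D}^{\alpha}f(t)=\frac{1}{\Gamma(n-\alpha)}\int_{0}^{t}\frac{f^{(n)}(s)}{(t-s)^{\alpha-n+1}}\,ds,$$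 with the usual convention $\mathcal{D}^{\alpha}f=f^{(n)}$ when $\alpha=n$ is an integer. In the claim, $\mathcal{D}^{\alpha}$ acts in the variable $t$. *)

theory Defs
  imports "HOL-Analysis.Analysis" "HOL-Computational_Algebra.Formal_Power_Series"
begin

(* For lam = 1 the denominator has subdegree 1 and the division cancels the factor fps_X,
   so this is the expansion at the removable singularity z = 0. *)
definition apostol_bernoulli_fps :: "real \<Rightarrow> real fps" where
  "apostol_bernoulli_fps lam = fps_X / (fps_const lam * fps_exp 1 - 1)"

lemma apostol_bernoulli_fps_mult: "apostol_bernoulli_fps lam * (fps_const lam * fps_exp 1 - 1) = fps_X"
proof -
  define g :: "real fps" where "g = fps_const lam * fps_exp 1 - 1"
  have "g dvd fps_X"
  proof (cases "lam = 1")
    case True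
    have "fps_nth g 1 = 1" "fps_nth g 0 = 0"
      using True by (simp_all add: g_def)
    hence "subdegree g = 1" "g \<noteq> 0"
      by (auto intro: subdegreeI)
    thus ?thesis by (simp add: fps_dvd_iff)
  next
    case False
    hence "fps_nth g 0 \<noteq> 0" by (simp add: g_def)
    thus ?thesis by (simp add: fps_is_unit_iff unit_imp_dvd)
  qed
  thus ?thesis by (simp add: apostol_bernoulli_fps_def g_def)
qed

definition apostol_bernoulli :: "real \<Rightarrow> nat \<Rightarrow> real" where
  "apostol_bernoulli lam s = fact s * fps_nth (apostol_bernoulli_fps lam) s"

definition apostol_bernoulli_poly :: "nat \<Rightarrow> nat \<Rightarrow> real \<Rightarrow> real \<Rightarrow> real" where
  "apostol_bernoulli_poly h m lam t = fact m * fps_nth (apostol_bernoulli_fps lam ^ h * fps_exp t) m"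

(* The index tuples (s_1, ..., s_h) with sum N are represented by the lists in natpermute N h. *)
definition multinomial :: "nat \<Rightarrow> nat list \<Rightarrow> real" where
  "multinomial N s = fact N / (\<Prod>j<length s. fact (s ! j))"

(* Only values of f on the open interval {0<..} matter; the integral is taken over the open
   interval since neither endpoint carries a meaningful value of the integrand. *)
definition caputo :: "real \<Rightarrow> (real \<Rightarrow> real) \<Rightarrow> real \<Rightarrow> real" where
  "caputo \<alpha> f t =
     (let n = nat \<lceil>\<alpha>\<rceil> in
      if \<alpha> = real n then (deriv ^^ n) f t
      else 1 / Gamma (real n - \<alpha>) *
             integral {0<..<t} (\<lambda>s. (deriv ^^ n) f s / (t - s) powr (\<alpha> - real n + 1)))"

end

theory Submission
  imports Defs
begin

text \<open>
  For a fixed power series \<open>G\<close>, here the \<open>h\<close>-th power of the Apostol-Bernoulli series, the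
  polynomials \<open>A\<^sub>m(t) = m! [z\<^sup>m] (G(z) e\<^bsup>tz\<^esup>)\<close> form an Appell sequence: differentiating
  \<open>e\<^bsup>tz\<^esup>\<close> in \<open>t\<close> multiplies it by \<open>z\<close>, so \<open>A\<^sub>m' = m A\<^bsub>m-1\<^esub>\<close>
  (\<open>has_real_derivative_appell\<close>), and the \<open>n\<close>-th derivative of \<open>A\<^sub>m\<close> is
  \<open>m!/(m-n)! A\<^bsub>m-n\<^esub>\<close>. This explains the factor in front of the sum.

  The coefficient of \<open>t\<^sup>k\<close> in \<open>A\<^bsub>m-n\<^esub>(t)\<close> is the binomial coefficient times
  \<open>(m-n-k)! [z\<^bsup>m-n-k\<^esup>] G\<close> (\<open>appell_expansion\<close>), and for an \<open>h\<close>-th power \<open>G\<close> the latter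
  number is the multinomial convolution of the Apostol-Bernoulli numbers
  (\<open>fact_mult_fps_power_nth\<close>).

  It remains to apply the fractional integral of order \<open>n - \<alpha>\<close> to each monomial \<open>t\<^sup>k\<close>. By Euler's
  Beta integral, rescaled to the interval from \<open>0\<close> to \<open>t\<close>, this gives
  \<open>k! t\<^bsup>k+n-\<alpha>\<^esup> / \<Gamma>(k+n-\<alpha>+1)\<close> (\<open>has_integral_Beta_rescaled\<close>, \<open>caputo_eq_sum\<close>). For \<open>\<alpha> = n\<close> that
  expression is \<open>t\<^sup>k\<close> itself, so the integer case obeys the same formula.
\<close>

section \<open>Appell sequences\<close>

definition appell :: "real fps \<Rightarrow> nat \<Rightarrow> real \<Rightarrow> real" where
  "appell G m t = fact m * fps_nth (G * fps_exp t) m"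

lemma appell_expansion:
  "appell G m t = (\<Sum>k\<le>m. real (m choose k) * (fact (m - k) * fps_nth G (m - k)) * t ^ k)"
proof -
  have "appell G m t = fact m * (\<Sum>k\<le>m. t ^ k / fact k * fps_nth G (m - k))"
    by (simp add: appell_def mult.commute[of G] fps_mult_nth atLeast0AtMost)
  also have "\<dots> = (\<Sum>k\<le>m. real (m choose k) * (fact (m - k) * fps_nth G (m - k)) * t ^ k)"
    unfolding sum_distrib_left by (intro sum.cong) (auto simp: binomial_fact)
  finally show ?thesis .
qed

text \<open>
  On coefficients the Appell property is the absorption identity
  \<open>(k + 1) \<cdot> binom (m + 1) (k + 1) = (m + 1) \<cdot> binom m k\<close>.
\<close>

lemma has_real_derivative_appell:
  "(appell G (Suc m) has_real_derivative real (Suc m) * appell G m t) (at t)"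
proof -
  define g where "g j = fact j * fps_nth G j" for j
  have expand: "appell G M = (\<lambda>t. \<Sum>k\<le>M. real (M choose k) * g (M - k) * t ^ k)" for M
    by (rule ext) (simp add: appell_expansion g_def)
  have "(appell G (Suc m) has_real_derivative
          (\<Sum>k\<le>Suc m. real (Suc m choose k) * g (Suc m - k) * (real k * t ^ (k - 1)))) (at t)"
    unfolding expand by (intro DERIV_sum DERIV_cmult) (auto intro!: derivative_eq_intros)
  also have "(\<Sum>k\<le>Suc m. real (Suc m choose k) * g (Suc m - k) * (real k * t ^ (k - 1))) =
      (\<Sum>k\<le>m. real (Suc k * (Suc m choose Suc k)) * (g (m - k) * t ^ k))"
    by (subst sum.atMost_Suc_shift) (simp add: algebra_simps del: binomial_Suc_Suc)
  also have "\<dots> = real (Suc m) * appell G m t"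
    unfolding Suc_times_binomial
    by (simp add: expand sum_distrib_left algebra_simps)
  finally show ?thesis .
qed

lemma deriv_iterate_appell:
  assumes "n \<le> m"
  shows "(deriv ^^ n) (appell G m) t = fact m / fact (m - n) * appell G (m - n) t"
  using assms
proof (induction n arbitrary: t)
  case (Suc n)
  define d where "d = m - Suc n"
  have d: "m - n = Suc d" using Suc.prems by (simp add: d_def)
  have "(deriv ^^ n) (appell G m) = (\<lambda>t. fact m / fact (Suc d) * appell G (Suc d) t)"
    using Suc.prems by (intro ext) (simp add: Suc.IH d del: fact_Suc)
  hence "(deriv ^^ Suc n) (appell G m) t =
           deriv (\<lambda>t. fact m / fact (Suc d) * appell G (Suc d) t) t"
    by (simp del: fact_Suc)
  also have "\<dots> = fact m / fact (Suc d) * (real (Suc d) * appell G d t)"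
    by (intro DERIV_imp_deriv DERIV_cmult has_real_derivative_appell)
  also have "\<dots> = fact m / fact d * appell G d t"
    by (simp add: fact_Suc field_simps del: of_nat_Suc)
  finally show ?case by (simp add: d_def)
qed simp

section \<open>Coefficients of a power\<close>

text \<open>
  Multiplying the Cauchy product of \<open>h\<close> copies of \<open>F\<close> by \<open>N!\<close> turns ordinary coefficients into
  exponential ones, at the cost of the multinomial coefficient.
\<close>

lemma fact_mult_fps_power_nth:
  fixes F :: "real fps"
  assumes "h \<ge> 1"
  shows "fact N * fps_nth (F ^ h) N =
    (\<Sum>s\<in>natpermute N h. multinomial N s * (\<Prod>j<h. fact (s ! j) * fps_nth F (s ! j)))"
proof -
  have interval: "{0..h - 1} = {..<h}" using assms by auto
  have "fact N * fps_nth (F ^ h) N =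
          (\<Sum>s\<in>natpermute N h. fact N * (\<Prod>j<h. fps_nth F (s ! j)))"
    unfolding fps_power_nth interval using assms by (simp add: sum_distrib_left)
  also have "\<dots> =
    (\<Sum>s\<in>natpermute N h. multinomial N s * (\<Prod>j<h. fact (s ! j) * fps_nth F (s ! j)))"
    by (intro sum.cong refl)
       (auto simp: multinomial_def prod.distrib natpermute_def)
  finally show ?thesis .
qed

section \<open>Fractional integration of monomials\<close>

text \<open>
  The substitution \<open>s = t x\<close> in Euler's integral contributes \<open>t\<^bsup>a-1\<^esup>\<close> and \<open>t\<^bsup>b-1\<^esup>\<close> from the two
  powers and one more \<open>t\<close> from the differential.
\<close>

lemma has_integral_Beta_rescaled:
  fixes a b t :: real
  assumes "a > 0" "b > 0" "t > 0"
  shows "((\<lambda>s. s powr (a - 1) * (t - s) powr (b - 1)) has_integral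
           t powr (a + b - 1) * Beta a b) {0<..<t}"
proof -
  define c where "c = t powr (a - 1) * t powr (b - 1)"
  define f where "f x = x powr (a - 1) * (1 - x) powr (b - 1)" for x :: real
  have image: "(\<lambda>x. x / (1 / t)) ` {0..1} = {0..t}"
    using \<open>t > 0\<close> image_divide_atLeastAtMost[of "1 / t" 0 1] by simp
  have "((\<lambda>s. f (1 / t * s)) has_integral (1 / \<bar>1 / t\<bar>) *\<^sub>R Beta a b) {0..t}"
    unfolding image[symmetric] f_def
    using has_integral_Beta_real[OF assms(1,2)] \<open>t > 0\<close> by (intro has_integral_stretch_real) auto
  from has_integral_mult_right[OF this, of c]
  have integral: "((\<lambda>s. c * f (s / t)) has_integral c * (t * Beta a b)) {0<..<t}"
    using \<open>t > 0\<close> by (simp add: has_integral_Icc_iff_Ioo)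
  have integrand: "c * f (s / t) = s powr (a - 1) * (t - s) powr (b - 1)" if "s \<in> {0<..<t}" for s
  proof -
    have "1 - s / t = (t - s) / t" using \<open>t > 0\<close> by (simp add: field_simps)
    thus ?thesis using that \<open>t > 0\<close> by (simp add: c_def f_def powr_divide)
  qed
  have val: "c * (t * Beta a b) = t powr (a + b - 1) * Beta a b"
  proof -
    have "c * t = t powr (a + b - 1)"
      using \<open>t > 0\<close> by (simp add: c_def powr_diff powr_add)
    thus ?thesis by (simp add: mult_ac)
  qed
  show ?thesis using has_integral_eq[OF integrand integral] unfolding val .
qed

text \<open>
  Convolving \<open>s\<^sup>k\<close> with the kernel \<open>(t - s)\<^bsup>\<beta>-1\<^esup>\<close>, \<open>\<beta> = n - \<alpha>\<close>, produces
  \<open>t\<^bsup>k+\<beta>\<^esup> B(k + 1, \<beta>)\<close>; the factor \<open>\<Gamma>(\<beta>)\<close> of the Beta value cancels the normalisation of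
  the Caputo derivative and leaves \<open>k! t\<^bsup>k+\<beta>\<^esup> / \<Gamma>(k + 1 + \<beta>)\<close>. The kernel is integrable at \<open>s = t\<close>
  because \<open>\<beta> > 0\<close> unless \<open>\<alpha>\<close> is an integer, where the Caputo derivative is the ordinary one.
\<close>

lemma caputo_eq_sum:
  fixes \<alpha> t :: real
  assumes "\<alpha> > 0" "t > 0" and n: "n = nat \<lceil>\<alpha>\<rceil>"
    and deriv: "\<And>s. s > 0 \<Longrightarrow> (deriv ^^ n) f s = (\<Sum>k\<le>N. a k * s ^ k)"
  shows "caputo \<alpha> f t =
    (\<Sum>k\<le>N. a k * fact k / Gamma (real n + real k - \<alpha> + 1) * t powr (real k - \<alpha> + real n))"
proof (cases "\<alpha> = real n")
  case True
  hence "caputo \<alpha> f t = (\<Sum>k\<le>N. a k * t ^ k)"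
    unfolding caputo_def Let_def n[symmetric] using \<open>t > 0\<close> by (simp add: deriv)
  also have "\<dots> =
    (\<Sum>k\<le>N. a k * fact k / Gamma (real n + real k - \<alpha> + 1) * t powr (real k - \<alpha> + real n))"
    using True \<open>t > 0\<close>
    by (intro sum.cong) (auto simp: powr_realpow add.commute[of _ 1] Gamma_fact)
  finally show ?thesis .
next
  case False
  define \<beta> where "\<beta> = real n - \<alpha>"
  have "\<alpha> \<le> real n" using \<open>\<alpha> > 0\<close> n by linarith
  hence "\<beta> > 0" using False by (simp add: \<beta>_def)
  have "((\<lambda>s. (deriv ^^ n) f s / (t - s) powr (\<alpha> - real n + 1)) has_integral
          (\<Sum>k\<le>N. a k * (t powr (real k + \<beta>) * Beta (real k + 1) \<beta>))) {0<..<t}"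
  proof (rule has_integral_eq)
    show "((\<lambda>s. \<Sum>k\<le>N. a k * (s powr real k * (t - s) powr (\<beta> - 1))) has_integral
            (\<Sum>k\<le>N. a k * (t powr (real k + \<beta>) * Beta (real k + 1) \<beta>))) {0<..<t}"
    proof (intro has_integral_sum has_integral_mult_right)
      fix k
      show "((\<lambda>s. s powr real k * (t - s) powr (\<beta> - 1)) has_integral
              t powr (real k + \<beta>) * Beta (real k + 1) \<beta>) {0<..<t}"
        using has_integral_Beta_rescaled[of "real k + 1" \<beta> t] \<open>\<beta> > 0\<close> \<open>t > 0\<close>
        by (simp add: algebra_simps)
    qed simp
  next
    fix s assume s: "s \<in> {0<..<t}"
    have kernel: "(t - s) powr (\<beta> - 1) = 1 / (t - s) powr (\<alpha> - real n + 1)"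
      by (simp add: \<beta>_def powr_minus_divide[symmetric] algebra_simps)
    show "(\<Sum>k\<le>N. a k * (s powr real k * (t - s) powr (\<beta> - 1))) =
            (deriv ^^ n) f s / (t - s) powr (\<alpha> - real n + 1)"
      using s unfolding kernel by (simp add: deriv powr_realpow sum_divide_distrib)
  qed
  hence "caputo \<alpha> f t =
      1 / Gamma \<beta> * (\<Sum>k\<le>N. a k * (t powr (real k + \<beta>) * Beta (real k + 1) \<beta>))"
    using False n unfolding caputo_def Let_def \<beta>_def by (simp add: integral_unique)
  also have "\<dots> =
    (\<Sum>k\<le>N. a k * fact k / Gamma (real n + real k - \<alpha> + 1) * t powr (real k - \<alpha> + real n))"
    unfolding sum_distrib_left
  proof (intro sum.cong refl)
    fix k
    have "Gamma \<beta> \<noteq> 0" using Gamma_real_pos[OF \<open>\<beta> > 0\<close>] by simp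
    moreover have "Gamma (real k + 1) = fact k"
      by (simp add: add.commute flip: Gamma_fact)
    moreover have "real n + real k - \<alpha> + 1 = real k + 1 + \<beta>" "real k - \<alpha> + real n = real k + \<beta>"
      by (simp_all add: \<beta>_def)
    ultimately show "1 / Gamma \<beta> * (a k * (t powr (real k + \<beta>) * Beta (real k + 1) \<beta>)) =
      a k * fact k / Gamma (real n + real k - \<alpha> + 1) * t powr (real k - \<alpha> + real n)"
      by (simp only: Beta_def) simp
  qed
  finally show ?thesis .
qed

section \<open>The Caputo derivative of the Apostol-Bernoulli polynomials\<close>

theorem theorem5:
  fixes \<alpha> lam t :: real and n h m :: nat
  assumes "\<alpha> > 0" and "lam > 0" and "n = nat \<lceil>\<alpha>\<rceil>" and "h \<ge> 1" and "m \<ge> n" and "t > 0"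
  shows "caputo \<alpha> (apostol_bernoulli_poly h m lam) t =
    Gamma (real m + 1) / Gamma (real m - real n + 1) *
    (\<Sum>k=0..m-n. fact k * real ((m - n) choose k) / Gamma (real n + real k - \<alpha> + 1) *
       t powr (real k - \<alpha> + real n) *
       (\<Sum>s\<in>natpermute (m - n - k) h.
          multinomial (m - n - k) s * (\<Prod>j<h. apostol_bernoulli lam (s ! j))))"
proof -
  define G where "G = apostol_bernoulli_fps lam ^ h"
  define C where "C N = (\<Sum>s\<in>natpermute N h.
          multinomial N s * (\<Prod>j<h. apostol_bernoulli lam (s ! j)))" for N
  have C: "fact N * fps_nth G N = C N" for N
    unfolding G_def C_def apostol_bernoulli_def by (rule fact_mult_fps_power_nth[OF \<open>h \<ge> 1\<close>])
  have appell: "apostol_bernoulli_poly h m lam = appell G m"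
    by (rule ext) (simp add: apostol_bernoulli_poly_def appell_def G_def)
  have factor: "Gamma (real m + 1) / Gamma (real m - real n + 1) = fact m / fact (m - n)"
    using \<open>m \<ge> n\<close> by (simp add: Gamma_fact add.commute flip: of_nat_diff)
  have "(deriv ^^ n) (apostol_bernoulli_poly h m lam) s =
      (\<Sum>k\<le>m - n. (fact m / fact (m - n) * (real ((m - n) choose k) * C (m - n - k))) * s ^ k)" for s
    unfolding appell deriv_iterate_appell[OF \<open>m \<ge> n\<close>] appell_expansion[of G "m - n"] C
    by (simp add: sum_distrib_left mult.assoc)
  from caputo_eq_sum[OF \<open>\<alpha> > 0\<close> \<open>t > 0\<close> \<open>n = nat \<lceil>\<alpha>\<rceil>\<close> this]
  show ?thesis
    unfolding factor C_def[symmetric] sum_distrib_left atLeast0AtMost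
    by (simp add: mult_ac)
qed

end
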